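(* Let $\Gamma$ be a numerical semigroup with multiplicity $m$. Then: (1) $\Gamma=\mathbb{N}$ if and only if $W_\Gamma(k)\ge 0$ for all $1\le k\le m$. (2) $\Gamma=\langle m,qm+1,\ldots,qm+(m-1)\rangle$ for some integer $q\ge 1$ if and only if $W_\Gamma(k)\le 0$ for all $1\le k\le m$. (3) Among the numerical semigroups $\Gamma\neq\mathbb{N}$ satisfying $W_\Gamma(k)\ge0$ for all $2\le k\le m(\Gamma)$ and $W_\Gamma(2)=0$, those of minimal embedding dimension are exactly the semigroups $\langle a,b\rangle$ with $a,b\ge 2$ and $\gcd(a,b)=1$.
   Context: A numerical semigroup is an additive submonoid $\Gamma\subseteq\mathbb{N}$ with finite complement; $\langle x_1,\dots,x_s\rangle$ denotes the submonoid generated by $x_1,\dots,x_s$. The multiplicity is $m=\min(\Gamma\setminus\{0\})$, the embedding dimension $e(\Gamma)$ is the cardinality of the minimal system of generators, the conductor $c(\Gamma)$ is one more than the largest integer not in $\Gamma$ (so $c(\mathbb{N})=0$), and $\delta(\Gamma)=|\{x\in\Gamma:x<c(\Gamma)\}|$. The Wilf function is $W_\Gamma(k)=k\delta(\Gamma)-c(\Gamma)$ for $k\in\mathbb{N}$. *)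

theory Defs
  imports Main
begin

definition submonoid :: "nat set \<Rightarrow> bool" where
  "submonoid M \<longleftrightarrow> 0 \<in> M \<and> (\<forall>x\<in>M. \<forall>y\<in>M. x + y \<in> M)"

definition numerical_semigroup :: "nat set \<Rightarrow> bool" where
  "numerical_semigroup \<Gamma> \<longleftrightarrow> submonoid \<Gamma> \<and> finite (- \<Gamma>)"

definition generated :: "nat set \<Rightarrow> nat set" where
  "generated X = \<Inter>{M. submonoid M \<and> X \<subseteq> M}"

definition semigroup_multiplicity :: "nat set \<Rightarrow> nat" where
  "semigroup_multiplicity \<Gamma> = (LEAST x. x \<in> \<Gamma> - {0})"

definition minimal_generators :: "nat set \<Rightarrow> nat set \<Rightarrow> bool" where
  "minimal_generators \<Gamma> A \<longleftrightarrow> generated A = \<Gamma> \<and> (\<forall>B. B \<subset> A \<longrightarrow> generated B \<noteq> \<Gamma>)"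

definition embedding_dim :: "nat set \<Rightarrow> nat" where
  "embedding_dim \<Gamma> = card (THE A. minimal_generators \<Gamma> A)"

text \<open>The largest gap is taken among all integers, negative ones included, so that it is
  \<open>-1\<close> for the full semigroup; hence the conductor has type \<^typ>\<open>int\<close>.\<close>

definition conductor :: "nat set \<Rightarrow> int" where
  "conductor \<Gamma> = (GREATEST z::int. z \<notin> int ` \<Gamma>) + 1"

lemma conductor_UNIV: "conductor UNIV = 0"
proof -
  have "(GREATEST z::int. z \<notin> range int) = -1"
  proof (rule Greatest_equality)
    fix y :: int
    assume "y \<notin> range int"
    then show "y \<le> -1"
      by (metis int_nat_eq linorder_not_le rangeI zle_add1_eq_le add.left_inverse)
  qed auto
  then show ?thesis
    by (simp add: conductor_def)
qed

definition delta :: "nat set \<Rightarrow> nat" where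
  "delta \<Gamma> = card {x \<in> \<Gamma>. int x < conductor \<Gamma>}"

definition wilf :: "nat set \<Rightarrow> nat \<Rightarrow> int" where
  "wilf \<Gamma> k = int k * int (delta \<Gamma>) - conductor \<Gamma>"

end

theory Submission
  imports Defs
begin

text \<open>
  Since \<open>W(k)\<close> is nondecreasing in \<open>k\<close>, parts (1) and (2) depend only on \<open>W(1)\<close> and \<open>W(m)\<close>.
  The number \<open>c - 1\<close> is a gap unless \<open>c = 0\<close>, so \<open>\<delta> < c\<close> for a proper semigroup, which is (1).
  The multiples of \<open>m\<close> below \<open>c\<close> lie in the semigroup and there are at least \<open>c / m\<close> of them, so
  \<open>m \<delta> \<ge> c\<close>, with equality iff \<open>c = \<delta> m\<close> and there are no other elements below \<open>c\<close>; this is (2).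
  For (3), the minimal generating set is the set of atoms, and a proper numerical semigroup has at
  least two atoms. Conversely, for coprime \<open>a\<close>, \<open>b\<close> the reflection \<open>z \<mapsto> ab - a - b - z\<close> exchanges
  the elements of \<open>\<langle>a, b\<rangle>\<close> with the other integers, which gives \<open>c = 2 \<delta>\<close>.
\<close>

section \<open>Generated submonoids and atoms\<close>

lemma submonoid_generated: "submonoid (generated X)"
  by (auto simp: generated_def submonoid_def)

lemma generated_superset: "X \<subseteq> generated X"
  by (auto simp: generated_def)

lemma generated_least: "submonoid M \<Longrightarrow> X \<subseteq> M \<Longrightarrow> generated X \<subseteq> M"
  by (auto simp: generated_def)

lemma submonoid_zero: "submonoid M \<Longrightarrow> 0 \<in> M"
  by (simp add: submonoid_def)

lemma submonoid_add: "submonoid M \<Longrightarrow> x \<in> M \<Longrightarrow> y \<in> M \<Longrightarrow> x + y \<in> M"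
  by (simp add: submonoid_def)

lemma submonoid_mult: "submonoid M \<Longrightarrow> x \<in> M \<Longrightarrow> i * x \<in> M"
  by (induction i) (auto intro: submonoid_zero submonoid_add)

lemma generated_pair: "generated {a, b} = {i * a + j * b | i j. True}"
proof
  have "submonoid {i * a + j * b | i j. True}"
    unfolding submonoid_def
  proof (intro conjI ballI)
    show "0 \<in> {i * a + j * b | i j. True}"
      by (auto intro: exI[of _ 0])
  next
    fix x y assume "x \<in> {i * a + j * b | i j. True}" "y \<in> {i * a + j * b | i j. True}"
    then obtain i j k l where "x = i * a + j * b" "y = k * a + l * b"
      by blast
    then have "x + y = (i + k) * a + (j + l) * b"
      by (simp add: algebra_simps)
    then show "x + y \<in> {i * a + j * b | i j. True}"
      by blast
  qed
  moreover have "{a, b} \<subseteq> {i * a + j * b | i j. True}"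
  proof -
    have "a = 1 * a + 0 * b" "b = 0 * a + 1 * b"
      by auto
    then show ?thesis
      by blast
  qed
  ultimately show "generated {a, b} \<subseteq> {i * a + j * b | i j. True}"
    by (rule generated_least)
  show "{i * a + j * b | i j. True} \<subseteq> generated {a, b}"
    using submonoid_add[OF submonoid_generated] submonoid_mult[OF submonoid_generated]
      generated_superset[of "{a, b}"] by auto
qed

text \<open>The irreducible elements. They will be the only minimal generating set, so that the
  \<open>THE\<close> in \<open>embedding_dim\<close> denotes them.\<close>

definition atoms :: "nat set \<Rightarrow> nat set" where
  "atoms M = {x \<in> M. x \<noteq> 0 \<and> (\<forall>y\<in>M. \<forall>z\<in>M. x = y + z \<longrightarrow> y = 0 \<or> z = 0)}"

text \<open>An atom is a sum of two elements only if one of them is 0, so removing it leaves a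
  submonoid. A generating set without the atom would stay inside that smaller submonoid.\<close>

lemma atoms_subset_generators:
  assumes "generated A = M"
  shows "atoms M \<subseteq> A"
proof
  fix x assume x: "x \<in> atoms M"
  show "x \<in> A"
  proof (rule ccontr)
    assume "x \<notin> A"
    have "submonoid (M - {x})"
      unfolding submonoid_def
    proof (intro conjI ballI)
      show "0 \<in> M - {x}"
        using submonoid_zero[OF submonoid_generated, of A] x assms by (simp add: atoms_def)
    next
      fix y z assume "y \<in> M - {x}" "z \<in> M - {x}"
      then show "y + z \<in> M - {x}"
        using submonoid_add[OF submonoid_generated, of y A z] x assms
        unfolding atoms_def by force
    qed
    then have "generated A \<subseteq> M - {x}"
      using \<open>x \<notin> A\<close> generated_superset[of A] assms by (intro generated_least) auto
    then show False
      using assms x by (auto simp: atoms_def)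
  qed
qed

text \<open>Strong induction: a nonzero element that is not an atom splits into two smaller
  elements.\<close>

lemma generated_atoms:
  assumes "submonoid M"
  shows "generated (atoms M) = M"
proof
  show "generated (atoms M) \<subseteq> M"
    using assms by (intro generated_least) (auto simp: atoms_def)
  have "x \<in> M \<Longrightarrow> x \<in> generated (atoms M)" for x
  proof (induction x rule: less_induct)
    case (less x)
    show ?case
    proof (cases "x = 0 \<or> x \<in> atoms M")
      case True
      then show ?thesis
        using generated_superset submonoid_zero[OF submonoid_generated] by blast
    next
      case False
      then obtain y z where "y \<in> M" "z \<in> M" "x = y + z" "y \<noteq> 0" "z \<noteq> 0"
        using less.prems unfolding atoms_def by blast
      then show ?thesis
        using less.IH[of y] less.IH[of z] submonoid_add[OF submonoid_generated] by auto
    qed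
  qed
  then show "M \<subseteq> generated (atoms M)" by blast
qed

lemma minimal_generators_iff:
  assumes "submonoid M"
  shows "minimal_generators M A \<longleftrightarrow> A = atoms M"
proof
  assume A: "minimal_generators M A"
  then have "atoms M \<subseteq> A"
    by (intro atoms_subset_generators) (simp add: minimal_generators_def)
  then show "A = atoms M"
    using A generated_atoms[OF assms] by (auto simp: minimal_generators_def)
next
  assume A: "A = atoms M"
  have "generated B \<noteq> M" if "B \<subset> A" for B
    using that atoms_subset_generators[of B M] A by auto
  then show "minimal_generators M A"
    using A generated_atoms[OF assms] by (simp add: minimal_generators_def)
qed

lemma embedding_dim_eq: "submonoid M \<Longrightarrow> embedding_dim M = card (atoms M)"
  by (simp add: embedding_dim_def minimal_generators_iff)

section \<open>Multiplicity and conductor\<close>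

lemma conductor_eqI:
  assumes "z - 1 \<notin> int ` \<Gamma>" and "\<And>y. y \<ge> z \<Longrightarrow> y \<in> int ` \<Gamma>"
  shows "conductor \<Gamma> = z"
proof -
  have "(GREATEST z. z \<notin> int ` \<Gamma>) = z - 1"
    using assms by (intro Greatest_equality) force+
  then show ?thesis
    by (simp add: conductor_def)
qed

text \<open>The guard \<open>c > 0\<close> is there because \<open>c - 1\<close> is truncated: for
  \<open>c = 0\<close> the largest gap is the integer -1.\<close>

lemma conductor_eq_int:
  assumes "\<And>n. n \<ge> c \<Longrightarrow> n \<in> \<Gamma>" and "c > 0 \<Longrightarrow> c - 1 \<notin> \<Gamma>"
  shows "conductor \<Gamma> = int c"
proof (rule conductor_eqI)
  show "int c - 1 \<notin> int ` \<Gamma>"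
  proof
    assume "int c - 1 \<in> int ` \<Gamma>"
    then obtain x where "int c - 1 = int x" "x \<in> \<Gamma>"
      by blast
    then have "c = Suc x"
      by linarith
    then show False
      using assms(2) \<open>x \<in> \<Gamma>\<close> by simp
  qed
  show "y \<in> int ` \<Gamma>" if "y \<ge> int c" for y
    using assms(1)[of "nat y"] that by (intro image_eqI[of _ _ "nat y"]) auto
qed

text \<open>Replaces the integer conductor by a natural number: the least start of a tail contained
  in \<Gamma>, whose predecessor is a gap by minimality.\<close>

lemma conductor_obtain:
  assumes "numerical_semigroup \<Gamma>"
  obtains c where "conductor \<Gamma> = int c" "\<And>n. n \<ge> c \<Longrightarrow> n \<in> \<Gamma>" "c > 0 \<Longrightarrow> c - 1 \<notin> \<Gamma>"
    "delta \<Gamma> = card {x \<in> \<Gamma>. x < c}"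
proof -
  define c where "c = (LEAST c. \<forall>n\<ge>c. n \<in> \<Gamma>)"
  have "finite (- \<Gamma>)"
    using assms by (simp add: numerical_semigroup_def)
  then obtain k where "\<forall>n\<in>-\<Gamma>. n < k"
    using finite_nat_set_iff_bounded by blast
  then have "\<forall>n\<ge>k. n \<in> \<Gamma>"
    using linorder_not_less by blast
  then have c: "\<forall>n\<ge>c. n \<in> \<Gamma>"
    unfolding c_def by (rule LeastI)
  have gap: "c - 1 \<notin> \<Gamma>" if "c > 0"
  proof
    assume "c - 1 \<in> \<Gamma>"
    then have "\<forall>n\<ge>c - 1. n \<in> \<Gamma>"
      using c by (metis Suc_pred' le_antisym not_less_eq_eq that)
    then have "c \<le> c - 1"
      unfolding c_def by (rule Least_le)
    then show False
      using that by simp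
  qed
  have "conductor \<Gamma> = int c"
    using c gap by (intro conductor_eq_int) auto
  then show ?thesis
    using that c gap by (simp add: delta_def)
qed

lemma multiplicity_props:
  assumes "numerical_semigroup \<Gamma>"
  shows "semigroup_multiplicity \<Gamma> \<in> \<Gamma>" "semigroup_multiplicity \<Gamma> > 0"
proof -
  obtain c where "\<And>n. n \<ge> c \<Longrightarrow> n \<in> \<Gamma>"
    using conductor_obtain[OF assms] by metis
  \<comment> \<open>As \<open>c\<close> may be 0, its successor serves as the nonzero
    witness.\<close>
  then have "Suc c \<in> \<Gamma> - {0}"
    by auto
  then have "semigroup_multiplicity \<Gamma> \<in> \<Gamma> - {0}"
    unfolding semigroup_multiplicity_def by (rule LeastI)
  then show "semigroup_multiplicity \<Gamma> \<in> \<Gamma>" "semigroup_multiplicity \<Gamma> > 0"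
    by auto
qed

section \<open>Monotonicity and the sign at k = 1 of the Wilf function\<close>

lemma wilf_mono: "k \<le> l \<Longrightarrow> wilf \<Gamma> k \<le> wilf \<Gamma> l"
  by (simp add: wilf_def mult_right_mono)

lemma wilf_UNIV: "wilf UNIV k = 0"
  by (simp add: wilf_def delta_def conductor_UNIV)

lemma wilf_1_neg:
  assumes "numerical_semigroup \<Gamma>" "\<Gamma> \<noteq> UNIV"
  shows "wilf \<Gamma> 1 < 0"
proof -
  obtain c where c: "conductor \<Gamma> = int c" "\<And>n. n \<ge> c \<Longrightarrow> n \<in> \<Gamma>" "c > 0 \<Longrightarrow> c - 1 \<notin> \<Gamma>"
    and d: "delta \<Gamma> = card {x \<in> \<Gamma>. x < c}"
    using conductor_obtain[OF assms(1)] by metis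
  have "c > 0"
    using c(2) assms(2) by (cases c) auto
  then have "{x \<in> \<Gamma>. x < c} \<subset> {..<c}"
    using c(3) by force
  then have "delta \<Gamma> < c"
    using psubset_card_mono[of "{..<c}" "{x \<in> \<Gamma>. x < c}"] d by simp
  then show ?thesis
    by (simp add: wilf_def c)
qed

lemma UNIV_iff_wilf_nonneg:
  assumes "numerical_semigroup \<Gamma>"
  shows "\<Gamma> = UNIV \<longleftrightarrow> (\<forall>k. 1 \<le> k \<and> k \<le> semigroup_multiplicity \<Gamma> \<longrightarrow> wilf \<Gamma> k \<ge> 0)"
proof
  assume "\<Gamma> = UNIV"
  then show "\<forall>k. 1 \<le> k \<and> k \<le> semigroup_multiplicity \<Gamma> \<longrightarrow> wilf \<Gamma> k \<ge> 0"
    by (simp add: wilf_UNIV)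
next
  assume "\<forall>k. 1 \<le> k \<and> k \<le> semigroup_multiplicity \<Gamma> \<longrightarrow> wilf \<Gamma> k \<ge> 0"
  then have "wilf \<Gamma> 1 \<ge> 0"
    using multiplicity_props(2)[OF assms] by simp
  then show "\<Gamma> = UNIV"
    using wilf_1_neg[OF assms] by linarith
qed

section \<open>Semigroups whose small elements are multiples of the multiplicity\<close>

text \<open>If m does not divide x and x >= qm, then the remainder r of x is between 1 and m - 1,
  and x is the generator qm + r plus a multiple of m. The explicit set makes conductor and delta
  countable.\<close>

lemma generated_interval:
  fixes m q :: nat
  assumes "m > 0" "q > 0"
  shows "generated (insert m {q * m + i | i. 1 \<le> i \<and> i \<le> m - 1}) = {x. m dvd x \<or> q * m \<le> x}"
    (is "generated ?X = ?S")
proof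
  have "submonoid ?S"
    by (auto simp: submonoid_def)
  then show "generated ?X \<subseteq> ?S"
    by (rule generated_least) auto
  have mult: "i * m \<in> generated ?X" for i
    using generated_superset[of ?X] by (intro submonoid_mult[OF submonoid_generated]) auto
  show "?S \<subseteq> generated ?X"
  proof
    fix x assume x: "x \<in> ?S"
    show "x \<in> generated ?X"
    proof (cases "m dvd x")
      case True
      then have "x div m * m = x"
        by simp
      then show ?thesis
        using mult[of "x div m"] by (simp only:)
    next
      case False
      then have "q * m \<le> x"
        using x by auto
      then have "q \<le> x div m"
        using assms div_le_mono[of "q * m" x m] by simp
      then have "(x div m - q) * m + q * m = x div m * m"
        by (simp flip: add_mult_distrib)
      then have eq: "x = (x div m - q) * m + (q * m + x mod m)"
        using div_mult_mod_eq[of x m] by linarith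
      have "q * m + x mod m \<in> ?X"
      proof -
        have "x mod m < m" "x mod m \<noteq> 0"
          using False assms by (auto simp: mod_eq_0_iff_dvd)
        then show ?thesis
          by (intro insertI2 CollectI exI[of _ "x mod m"]) auto
      qed
      then have "q * m + x mod m \<in> generated ?X"
        using generated_superset by (rule rev_subsetD)
      then show ?thesis
        by (subst eq) (rule submonoid_add[OF submonoid_generated mult])
    qed
  qed
qed

lemma card_multiples_below: "m > 0 \<Longrightarrow> card {x. m dvd x \<and> x < q * m} = q" for m q :: nat
proof -
  assume "m > 0"
  then have "{x. m dvd x \<and> x < q * m} = (\<lambda>i. i * m) ` {..<q}"
    by (auto elim!: dvdE)
  then show ?thesis
    using \<open>m > 0\<close> by (simp add: card_image inj_on_def)
qed

text \<open>For m >= 2 the conductor is qm and delta is q, so W(k) = (k - m)q.\<close>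

lemma wilf_interval:
  fixes m q k :: nat
  assumes "m > 0" "q > 0" "k \<le> m"
  shows "wilf {x. m dvd x \<or> q * m \<le> x} k \<le> 0" (is "wilf ?S k \<le> 0")
proof (cases "m = 1")
  \<comment> \<open>For m = 1 the set is all of N, whose conductor is 0 and not qm.\<close>
  case True
  then show ?thesis
    by (simp add: wilf_UNIV)
next
  case False
  \<comment> \<open>Otherwise m would divide 1. Hence qm - 1 is a gap and the conductor is not
    smaller than qm.\<close>
  have "\<not> m dvd q * m - 1"
    using assms False by (metis One_nat_def dvd_diffD1 dvd_triv_right le_antisym
      nat_0_less_mult_iff nat_dvd_1_iff_1 Suc_leI)
  then have c: "conductor ?S = int (q * m)"
    using assms by (intro conductor_eq_int) auto
  have "{x \<in> ?S. int x < conductor ?S} = {x. m dvd x \<and> x < q * m}"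
    unfolding c of_nat_less_iff by auto
  then have "delta ?S = q"
    using assms by (simp add: delta_def card_multiples_below)
  then show ?thesis
    using assms unfolding wilf_def c by simp
qed

text \<open>Put q = delta. Then W(m) <= 0 says qm <= c, so the q multiples of m below qm are among
  the q elements below c and exhaust them.\<close>

lemma interval_of_wilf_multiplicity_le_0:
  assumes \<Gamma>: "numerical_semigroup \<Gamma>" and m: "m \<in> \<Gamma>" "m > 0" and W: "wilf \<Gamma> m \<le> 0"
    and "\<Gamma> \<noteq> UNIV"
  shows "\<exists>q>0. \<Gamma> = {x. m dvd x \<or> q * m \<le> x}"
proof -
  obtain c where c: "conductor \<Gamma> = int c" "\<And>n. n \<ge> c \<Longrightarrow> n \<in> \<Gamma>"
    and d: "delta \<Gamma> = card {x \<in> \<Gamma>. x < c}"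
    using conductor_obtain[OF \<Gamma>] by metis
  have mult: "x \<in> \<Gamma>" if "m dvd x" for x
    using that m submonoid_mult[of \<Gamma> m "x div m"] \<Gamma> by (simp add: numerical_semigroup_def)
  define q where "q = delta \<Gamma>"
  have "int (m * q) \<le> int c"
    using W by (simp add: wilf_def c q_def)
  then have le: "q * m \<le> c"
    by (simp only: of_nat_le_iff mult.commute)
  have "q * m = c \<and> {x \<in> \<Gamma>. x < c} = {x. m dvd x \<and> x < q * m}"
  proof -
    have "{x. m dvd x \<and> x < q * m} \<subseteq> {x \<in> \<Gamma>. x < c}"
      using mult le by auto
    moreover have "card {x. m dvd x \<and> x < q * m} = card {x \<in> \<Gamma>. x < c}"
      using card_multiples_below[OF m(2), of q] d by (simp add: q_def)
    ultimately have eq: "{x. m dvd x \<and> x < q * m} = {x \<in> \<Gamma>. x < c}"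
      by (intro card_subset_eq) auto
    \<comment> \<open>Otherwise qm would be one more element below c.\<close>
    have "\<not> q * m < c"
    proof
      assume "q * m < c"
      then have "q * m \<in> {x \<in> \<Gamma>. x < c}"
        using mult by simp
      then show False
        using eq by blast
    qed
    then show ?thesis
      using le eq by simp
  qed
  then have qm: "q * m = c" and below: "\<And>x. x < c \<Longrightarrow> x \<in> \<Gamma> \<longleftrightarrow> m dvd x"
    by blast+
  have "x \<in> \<Gamma> \<longleftrightarrow> m dvd x \<or> q * m \<le> x" for x
    unfolding qm using below[of x] mult[of x] c(2)[of x] by (cases "x < c") auto
  then have "\<Gamma> = {x. m dvd x \<or> q * m \<le> x}"
    by blast
  moreover have "q > 0"
  proof (rule ccontr)
    assume "\<not> q > 0"
    then have "c = 0"
      using qm by simp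
    then show False
      using c(2) \<open>\<Gamma> \<noteq> UNIV\<close> by auto
  qed
  ultimately show ?thesis
    by blast
qed

lemma interval_iff_wilf_nonpos:
  assumes \<Gamma>: "numerical_semigroup \<Gamma>" and m: "m = semigroup_multiplicity \<Gamma>"
  shows "(\<exists>q\<ge>1. \<Gamma> = generated (insert m {q * m + i | i. 1 \<le> i \<and> i \<le> m - 1})) \<longleftrightarrow>
    (\<forall>k. 1 \<le> k \<and> k \<le> m \<longrightarrow> wilf \<Gamma> k \<le> 0)"
proof -
  have m0: "m \<in> \<Gamma>" "m > 0"
    using multiplicity_props[OF \<Gamma>] m by auto
  have "(\<exists>q\<ge>1. \<Gamma> = generated (insert m {q * m + i | i. 1 \<le> i \<and> i \<le> m - 1})) \<longleftrightarrow>
      (\<exists>q>0. \<Gamma> = {x. m dvd x \<or> q * m \<le> x})"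
    by (metis (no_types, lifting) One_nat_def Suc_le_eq generated_interval[OF m0(2)])
  also have "\<dots> \<longleftrightarrow> (\<forall>k. 1 \<le> k \<and> k \<le> m \<longrightarrow> wilf \<Gamma> k \<le> 0)"
  proof
    assume "\<exists>q>0. \<Gamma> = {x. m dvd x \<or> q * m \<le> x}"
    then show "\<forall>k. 1 \<le> k \<and> k \<le> m \<longrightarrow> wilf \<Gamma> k \<le> 0"
      using wilf_interval[OF m0(2)] by blast
  next
    assume W: "\<forall>k. 1 \<le> k \<and> k \<le> m \<longrightarrow> wilf \<Gamma> k \<le> 0"
    show "\<exists>q>0. \<Gamma> = {x. m dvd x \<or> q * m \<le> x}"
    proof (cases "\<Gamma> = UNIV")
      \<comment> \<open>Here the conductor is 0 and delta would give q = 0; since m = 1 divides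
        everything, any positive q serves.\<close>
      case True
      then have "m = 1"
        unfolding m semigroup_multiplicity_def by (intro Least_equality) auto
      then show ?thesis
        using True by auto
    next
      case False
      then show ?thesis
        using interval_of_wilf_multiplicity_le_0[OF \<Gamma> m0] W m0 by simp
    qed
  qed
  finally show ?thesis .
qed

section \<open>Symmetric semigroups and two generators\<close>

text \<open>The reflection at F/2 matches the elements in {0..F} with the gaps there, so exactly
  half of these F + 1 = c numbers are elements. Working over the integers, negative numbers count as
  non-elements: 0 reflects to the gap F, and everything above F reflects to a negative
  number.\<close>

lemma symmetric_conductor_delta:
  fixes F :: int
  assumes "0 \<in> \<Gamma>" and sym: "\<And>z. z \<in> int ` \<Gamma> \<longleftrightarrow> F - z \<notin> int ` \<Gamma>"
  shows "conductor \<Gamma> = F + 1" "conductor \<Gamma> = 2 * int (delta \<Gamma>)"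
proof -
  show c: "conductor \<Gamma> = F + 1"
  proof (rule conductor_eqI)
    have "0 \<in> int ` \<Gamma>"
      using assms(1) by force
    then show "F + 1 - 1 \<notin> int ` \<Gamma>"
      using sym[of 0] by simp
    show "y \<in> int ` \<Gamma>" if "y \<ge> F + 1" for y
      unfolding sym[of y] using that by auto
  qed
  define S where "S = int ` {x \<in> \<Gamma>. int x < conductor \<Gamma>}"
  have S: "z \<in> S \<longleftrightarrow> z \<in> int ` \<Gamma> \<and> z \<le> F" for z
    unfolding S_def c by auto
  have S_sub: "S \<subseteq> {0..F}"
    by (auto simp: S)
  have T: "{0..F} - S = (\<lambda>z. F - z) ` S"
  proof (intro equalityI subsetI)
    fix z assume z: "z \<in> {0..F} - S"
    then have "z \<notin> int ` \<Gamma>"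
      by (metis DiffE S atLeastAtMost_iff)
    then have "F - z \<in> S"
      using sym[of z] z unfolding S by auto
    then show "z \<in> (\<lambda>z. F - z) ` S"
      by (intro image_eqI[of _ _ "F - z"]) auto
  next
    fix z assume "z \<in> (\<lambda>z. F - z) ` S"
    then obtain y where y: "y \<in> S" "z = F - y"
      by blast
    then have "z \<notin> int ` \<Gamma>"
      using S[of y] sym[of y] by simp
    then show "z \<in> {0..F} - S"
      using y S S_sub by auto
  qed
  have fin: "finite S"
    using S_sub finite_subset by blast
  \<comment> \<open>Reflecting -1 shows F >= -1, so the cardinality of {0..F} really is F +
    1.\<close>
  have "-1 \<notin> int ` \<Gamma>"
    by auto
  then have "F + 1 \<in> int ` \<Gamma>"
    using sym[of "-1"] by simp
  then have "F + 1 \<ge> 0"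
    by auto
  have "card {0..F} = card S + card ({0..F} - S)"
    using card_Diff_subset[OF fin S_sub] card_mono[OF _ S_sub] by simp
  also have "card ({0..F} - S) = card S"
    unfolding T by (rule card_image) (simp add: inj_on_def)
  also have "card S = delta \<Gamma>"
    unfolding S_def delta_def by (rule card_image) simp
  finally show "conductor \<Gamma> = 2 * int (delta \<Gamma>)"
    using \<open>F + 1 \<ge> 0\<close> unfolding c by simp
qed

section \<open>Normal forms and the symmetry of a two-generator semigroup\<close>

lemma int_image_generated_pair:
  "z \<in> int ` generated {a, b} \<longleftrightarrow> (\<exists>i\<ge>0. \<exists>j\<ge>0. z = i * int a + j * int b)"
proof
  assume "z \<in> int ` generated {a, b}"
  then obtain i j where "z = int i * int a + int j * int b"
    by (auto simp: generated_pair)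
  then show "\<exists>i\<ge>0. \<exists>j\<ge>0. z = i * int a + j * int b"
    using of_nat_0_le_iff by blast
next
  assume "\<exists>i\<ge>0. \<exists>j\<ge>0. z = i * int a + j * int b"
  then obtain i j where "i \<ge> 0" "j \<ge> 0" "z = i * int a + j * int b"
    by blast
  then have "z = int (nat i * a + nat j * b)"
    by simp
  then show "z \<in> int ` generated {a, b}"
    unfolding generated_pair by blast
qed

text \<open>With v < 0 and a second representation by i, j >= 0, the number (u - i)a = (j - v)b is
  positive. By coprimality b divides u - i > 0, against u < b.\<close>

lemma generated_pair_normal_form:
  fixes a b :: nat and u v :: int
  assumes "a > 0" "b > 0" "coprime a b" "0 \<le> u" "u < int b"
  shows "u * int a + v * int b \<in> int ` generated {a, b} \<longleftrightarrow> v \<ge> 0"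
proof
  assume "u * int a + v * int b \<in> int ` generated {a, b}"
  then obtain i j where ij: "i \<ge> 0" "j \<ge> 0" "u * int a + v * int b = i * int a + j * int b"
    unfolding int_image_generated_pair by blast
  show "v \<ge> 0"
  proof (rule ccontr)
    assume "\<not> v \<ge> 0"
    have eq: "(u - i) * int a = (j - v) * int b"
      using ij(3) by (simp add: algebra_simps)
    then have "int b dvd (u - i) * int a"
      by simp
    then have "int b dvd u - i"
      using assms(3) by (simp add: coprime_dvd_mult_left_iff coprime_commute)
    moreover have "(u - i) * int a > 0"
      unfolding eq using \<open>\<not> v \<ge> 0\<close> ij assms by simp
    then have "u - i > 0"
      using assms(1) by (simp add: zero_less_mult_iff)
    ultimately have "int b \<le> u - i"
      by (rule zdvd_imp_le)
    then show False
      using assms ij by simp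
  qed
next
  assume "v \<ge> 0"
  then show "u * int a + v * int b \<in> int ` generated {a, b}"
    unfolding int_image_generated_pair using assms by blast
qed

text \<open>The reflection sends the coefficients (u, v) to (b - 1 - u, -1 - v), again in normal
  form, and exactly one of v and -1 - v is nonnegative.\<close>

lemma generated_pair_symmetric:
  fixes a b :: nat
  assumes "a > 0" "b > 0" "coprime a b"
  shows "z \<in> int ` generated {a, b} \<longleftrightarrow>
    int a * int b - int a - int b - z \<notin> int ` generated {a, b}"
proof -
  obtain s t where st: "s * int a + t * int b = 1"
    using bezout_int[of "int a" "int b"] assms(3) by auto
  \<comment> \<open>From z = (zs)a + (zt)b: the first coefficient is reduced modulo b, and its
    quotient times a moves to the second.\<close>
  define u v where "u = (z * s) mod int b" and "v = ((z * s) div int b) * int a + z * t"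
  have u: "0 \<le> u" "u < int b"
    using assms by (auto simp: u_def)
  have "z * s = (z * s) div int b * int b + u"
    by (simp add: u_def)
  then have "u = z * s - (z * s) div int b * int b"
    by linarith
  then have "u * int a + v * int b = z * (s * int a + t * int b)"
    unfolding v_def by (simp only:) (simp add: algebra_simps)
  then have z: "z = u * int a + v * int b"
    by (simp add: st)
  have "int a * int b - int a - int b - z = (int b - 1 - u) * int a + (- 1 - v) * int b"
    unfolding z by (simp add: algebra_simps)
  then have "int a * int b - int a - int b - z \<in> int ` generated {a, b} \<longleftrightarrow> - 1 - v \<ge> 0"
    using generated_pair_normal_form[OF assms, of "int b - 1 - u" "- 1 - v"] u by simp
  moreover have "z \<in> int ` generated {a, b} \<longleftrightarrow> v \<ge> 0"
    using generated_pair_normal_form[OF assms u] z by simp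
  ultimately show ?thesis
    by auto
qed

text \<open>A gap reflects to an element, which is nonnegative, so gaps are at most ab - a - b; the
  cruder bound ab is enough for finiteness.\<close>

lemma generated_pair_numerical:
  fixes a b :: nat
  assumes "a > 0" "b > 0" "coprime a b"
  shows "numerical_semigroup (generated {a, b})"
proof -
  have "- generated {a, b} \<subseteq> {..a * b}"
  proof
    fix x assume "x \<in> - generated {a, b}"
    then have "int x \<notin> int ` generated {a, b}"
      by auto
    then have "int a * int b - int a - int b - int x \<in> int ` generated {a, b}"
      using generated_pair_symmetric[OF assms, of "int x"] by simp
    then have "int x \<le> int a * int b"
      by auto
    then show "x \<in> {..a * b}"
      by (metis atMost_iff of_nat_le_iff of_nat_mult)
  qed
  then show ?thesis
    using finite_subset submonoid_generated by (auto simp: numerical_semigroup_def)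
qed

lemma generated_pair_wilf_2:
  assumes "a > 0" "b > 0" "coprime a b"
  shows "wilf (generated {a, b}) 2 = 0"
  using symmetric_conductor_delta(2)[OF submonoid_zero[OF submonoid_generated]
      generated_pair_symmetric[OF assms]]
  by (simp add: wilf_def)

lemma generated_pair_neq_UNIV:
  assumes "a \<ge> 2" "b \<ge> 2"
  shows "generated {a, b} \<noteq> UNIV"
proof -
  have "submonoid (- {1})"
    by (auto simp: submonoid_def)
  then have "generated {a, b} \<subseteq> - {1}"
    using assms by (intro generated_least) auto
  then show ?thesis
    by auto
qed

section \<open>Embedding dimension two\<close>

lemma embedding_dim_pair_le: "embedding_dim (generated {a, b}) \<le> 2"
proof -
  have "card (atoms (generated {a, b})) \<le> card {a, b}"
    by (intro card_mono atoms_subset_generators) auto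
  also have "\<dots> \<le> 2"
    by (simp add: card_insert_if)
  finally show ?thesis
    by (simp add: embedding_dim_eq submonoid_generated)
qed

text \<open>A numerical semigroup contains two consecutive numbers, both divisible by d. The value d
  = 0 is allowed, which later excludes an empty generating set.\<close>

lemma numerical_generators_dvd:
  assumes "numerical_semigroup (generated A)" "\<And>x. x \<in> A \<Longrightarrow> d dvd x"
  shows "d = 1"
proof -
  have "generated A \<subseteq> {x. d dvd x}"
    using assms(2) by (intro generated_least) (auto simp: submonoid_def)
  moreover obtain c where "\<And>n. n \<ge> c \<Longrightarrow> n \<in> generated A"
    using conductor_obtain[OF assms(1)] by metis
  then have "c \<in> generated A" "c + 1 \<in> generated A"
    by auto
  ultimately have "d dvd c" "d dvd c + 1"
    by auto
  then show "d = 1"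
    using dvd_add_right_iff[of d c 1] by simp
qed

lemma generated_eq_UNIV: "1 \<in> A \<Longrightarrow> generated A = UNIV"
  using submonoid_mult[OF submonoid_generated, of 1 A] generated_superset[of A] by auto

text \<open>Beyond c + m an element x splits as m + (x - m). Finiteness matters because
  \<open>card\<close> is 0 on infinite sets, so a small \<open>card\<close> alone would not bound
  the atoms.\<close>

lemma finite_atoms:
  assumes "numerical_semigroup \<Gamma>"
  shows "finite (atoms \<Gamma>)"
proof -
  obtain c where c: "\<And>n. n \<ge> c \<Longrightarrow> n \<in> \<Gamma>"
    using conductor_obtain[OF assms] by metis
  let ?m = "semigroup_multiplicity \<Gamma>"
  have "atoms \<Gamma> \<subseteq> {..c + ?m}"
  proof
    fix x assume x: "x \<in> atoms \<Gamma>"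
    show "x \<in> {..c + ?m}"
    proof (rule ccontr)
      assume "x \<notin> {..c + ?m}"
      then have "x - ?m \<in> \<Gamma>" "x - ?m \<noteq> 0" "x = ?m + (x - ?m)"
        using c by auto
      then show False
        using x multiplicity_props[OF assms] unfolding atoms_def
        by (metis (mono_tags, lifting) mem_Collect_eq not_gr0)
    qed
  qed
  then show ?thesis
    by (rule finite_subset) simp
qed

lemma embedding_dim_ge_2:
  assumes "numerical_semigroup \<Gamma>" "\<Gamma> \<noteq> UNIV"
  shows "embedding_dim \<Gamma> \<ge> 2"
proof (rule ccontr)
  have sub: "submonoid \<Gamma>"
    using assms by (simp add: numerical_semigroup_def)
  assume "\<not> embedding_dim \<Gamma> \<ge> 2"
  then have "card (atoms \<Gamma>) \<le> Suc 0"
    by (simp add: embedding_dim_eq sub)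
  then obtain d where d: "atoms \<Gamma> \<subseteq> {d}"
    using finite_atoms[OF assms(1)] by (metis card_le_Suc0_iff_eq insertI1 subsetI)
  have gen: "generated {d} = \<Gamma>"
  proof (cases "atoms \<Gamma> = {}")
    case True
    then have "\<Gamma> = generated {}"
      using generated_atoms[OF sub] by simp
    \<comment> \<open>Vacuously, 0 divides every element of the empty set.\<close>
    then have "(0::nat) = 1"
      using assms(1) numerical_generators_dvd[of "{}" 0] by simp
    then show ?thesis
      by simp
  next
    case False
    then show ?thesis
      using d generated_atoms[OF sub] by (metis subset_singletonD)
  qed
  then have "d = 1"
    using assms(1) numerical_generators_dvd[of "{d}" d] by simp
  then show False
    using gen assms(2) generated_eq_UNIV[of "{d}"] by simp
qed

text \<open>The generators are the two atoms: their gcd is a common divisor, hence 1, and the atom 1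
  would give all of N.\<close>

lemma embedding_dim_2_imp_pair:
  assumes "numerical_semigroup \<Gamma>" "\<Gamma> \<noteq> UNIV" "embedding_dim \<Gamma> = 2"
  shows "\<exists>a b. \<Gamma> = generated {a, b} \<and> a \<ge> 2 \<and> b \<ge> 2 \<and> gcd a b = 1"
proof -
  have sub: "submonoid \<Gamma>"
    using assms by (simp add: numerical_semigroup_def)
  then have "card (atoms \<Gamma>) = 2"
    using assms(3) by (simp add: embedding_dim_eq)
  then obtain a b where ab: "atoms \<Gamma> = {a, b}"
    by (auto simp: card_2_iff)
  then have gen: "generated {a, b} = \<Gamma>"
    using generated_atoms[OF sub] by simp
  have "gcd a b = 1"
    using assms(1) gen by (intro numerical_generators_dvd[of "{a, b}"]) auto
  moreover have "x \<ge> 2" if "x \<in> {a, b}" for x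
  proof -
    have "x \<in> atoms \<Gamma>"
      using that ab by simp
    then have "x \<noteq> 0"
      by (simp add: atoms_def)
    moreover have "x \<noteq> 1"
      using that assms(2) gen generated_eq_UNIV[of "{a, b}"] by auto
    ultimately show ?thesis
      by linarith
  qed
  ultimately show ?thesis
    using gen by (intro exI[of _ a] exI[of _ b]) simp
qed

theorem theorem3p8:
  "(\<forall>\<Gamma> m. numerical_semigroup \<Gamma> \<longrightarrow> m = semigroup_multiplicity \<Gamma> \<longrightarrow>
      (\<Gamma> = UNIV \<longleftrightarrow> (\<forall>k. 1 \<le> k \<and> k \<le> m \<longrightarrow> wilf \<Gamma> k \<ge> 0)) \<and>
      ((\<exists>q\<ge>1. \<Gamma> = generated (insert m {q * m + i | i. 1 \<le> i \<and> i \<le> m - 1})) \<longleftrightarrow>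
        (\<forall>k. 1 \<le> k \<and> k \<le> m \<longrightarrow> wilf \<Gamma> k \<le> 0))) \<and>
   {\<Gamma>. is_arg_min embedding_dim
          (\<lambda>\<Gamma>. numerical_semigroup \<Gamma> \<and> \<Gamma> \<noteq> UNIV \<and>
            (\<forall>k. 2 \<le> k \<and> k \<le> semigroup_multiplicity \<Gamma> \<longrightarrow> wilf \<Gamma> k \<ge> 0) \<and>
            wilf \<Gamma> 2 = 0) \<Gamma>}
     = {generated {a, b} | a b. a \<ge> 2 \<and> b \<ge> 2 \<and> gcd a b = 1}"
proof (intro conjI allI impI)
  fix \<Gamma> :: "nat set" and m
  assume "numerical_semigroup \<Gamma>" "m = semigroup_multiplicity \<Gamma>"
  then show "\<Gamma> = UNIV \<longleftrightarrow> (\<forall>k. 1 \<le> k \<and> k \<le> m \<longrightarrow> wilf \<Gamma> k \<ge> 0)"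
    and "(\<exists>q\<ge>1. \<Gamma> = generated (insert m {q * m + i | i. 1 \<le> i \<and> i \<le> m - 1})) \<longleftrightarrow>
        (\<forall>k. 1 \<le> k \<and> k \<le> m \<longrightarrow> wilf \<Gamma> k \<le> 0)"
    using UNIV_iff_wilf_nonneg interval_iff_wilf_nonpos by auto
next
  define P where "P = (\<lambda>\<Gamma>. numerical_semigroup \<Gamma> \<and> \<Gamma> \<noteq> UNIV \<and>
    (\<forall>k. 2 \<le> k \<and> k \<le> semigroup_multiplicity \<Gamma> \<longrightarrow> wilf \<Gamma> k \<ge> 0) \<and> wilf \<Gamma> 2 = 0)"
  have pair: "P (generated {a, b})" "embedding_dim (generated {a, b}) = 2"
    if "a \<ge> 2" "b \<ge> 2" "gcd a b = 1" for a b
  proof -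
    have ab: "a > 0" "b > 0" "coprime a b"
      using that by (auto simp: coprime_iff_gcd_eq_1)
    note W = generated_pair_wilf_2[OF ab]
    \<comment> \<open>Monotonicity carries W(2) = 0 to W(k) >= 0 for all k >= 2.\<close>
    show "P (generated {a, b})"
      unfolding P_def
      using generated_pair_numerical[OF ab] generated_pair_neq_UNIV[OF that(1,2)] W
        wilf_mono[of 2 _ "generated {a, b}"] by auto
    show "embedding_dim (generated {a, b}) = 2"
      using embedding_dim_pair_le[of a b] generated_pair_numerical[OF ab]
        generated_pair_neq_UNIV[OF that(1,2)] embedding_dim_ge_2 by (metis le_antisym)
  qed
  have ge: "embedding_dim \<Gamma> \<ge> 2" if "P \<Gamma>" for \<Gamma>
    using that embedding_dim_ge_2 by (auto simp: P_def)
  have "is_arg_min embedding_dim P \<Gamma> \<longleftrightarrow>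
      (\<exists>a b. \<Gamma> = generated {a, b} \<and> a \<ge> 2 \<and> b \<ge> 2 \<and> gcd a b = 1)" for \<Gamma>
  proof
    assume min: "is_arg_min embedding_dim P \<Gamma>"
    \<comment> \<open>The semigroup generated by 2 and 3 shows that dimension 2 is attained, so
      every minimizer has dimension exactly 2.\<close>
    have "gcd 2 3 = (1::nat)"
      by (simp add: gcd_non_0_nat)
    then have "embedding_dim \<Gamma> \<le> 2"
      using min pair[of 2 3] by (auto simp: is_arg_min_linorder)
    then have "embedding_dim \<Gamma> = 2" "P \<Gamma>"
      using min ge by (auto simp: is_arg_min_def intro: le_antisym)
    then show "\<exists>a b. \<Gamma> = generated {a, b} \<and> a \<ge> 2 \<and> b \<ge> 2 \<and> gcd a b = 1"
      using embedding_dim_2_imp_pair by (auto simp: P_def)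
  next
    assume "\<exists>a b. \<Gamma> = generated {a, b} \<and> a \<ge> 2 \<and> b \<ge> 2 \<and> gcd a b = 1"
    then show "is_arg_min embedding_dim P \<Gamma>"
      using pair ge by (auto simp: is_arg_min_linorder)
  qed
  then show "{\<Gamma>. is_arg_min embedding_dim
          (\<lambda>\<Gamma>. numerical_semigroup \<Gamma> \<and> \<Gamma> \<noteq> UNIV \<and>
            (\<forall>k. 2 \<le> k \<and> k \<le> semigroup_multiplicity \<Gamma> \<longrightarrow> wilf \<Gamma> k \<ge> 0) \<and>
            wilf \<Gamma> 2 = 0) \<Gamma>}
     = {generated {a, b} | a b. a \<ge> 2 \<and> b \<ge> 2 \<and> gcd a b = 1}"
    unfolding P_def by (simp only:)
qed

end
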